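(* Suppose that $\pi_\Psi$ is positive and continuous and that we have a regular discretization $\{B_\lambda(\psi)\}$, $\lambda>0$, of $\Psi(\Theta)$. Further suppose that $\psi_{RB}(x)$ is the unique maximizer of $RB_\Psi(\psi\,|\,x)$ and that for any $\epsilon>0$ $$\sup_{\{\psi:\|\psi-\psi_{RB}(x)\|\ge\epsilon\}}RB_\Psi(\psi\,|\,x)<RB_\Psi(\psi_{RB}(x)\,|\,x).$$ Then there exists $\eta(\lambda)\downarrow0$ as $\lambda\to0$ such that a Bayes rule $\delta_{\lambda,\eta(\lambda)}(x)$, under the loss $L_{RB,\lambda,\eta(\lambda)}$, converges to $\psi_{RB}(x)$ as $\lambda\to0$ for all $x$.
   Context: Setting. $\{f(\cdot\,|\,\theta):\theta\in\Theta\}$ is a family of probability densities on a sample space $\mathcal X$; $\Theta$ carries a proper prior $\Pi$ with density $\pi$. The prior predictive density is $m(x)=\int_\Theta f(x\,|\,\theta)\,\Pi(d\theta)$, and the posterior has density $\pi(\theta\,|\,x)=\pi(\theta)f(x\,|\,\theta)/m(x)$. $\Psi:\Theta\to\Psi(\Theta)$ is a parameter of interest. All spaces are open subsets of Euclidean spaces, the support measures (with respect to which densities are taken) are Euclidean volume, and mappings are assumed sufficiently smooth; $\nu_\Psi$ denotes Euclidean volume on $\Psi(\Theta)$. The marginal prior $\Pi_\Psi$ and marginal posterior $\Pi_\Psi(\cdot\,|\,x)$ on $\Psi(\Theta)$ have densities $\pi_\Psi$ and $\pi_\Psi(\cdot\,|\,x)$ with respect to $\nu_\Psi$. The relative belief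 ratio is $RB_\Psi(\psi\,|\,x)=\pi_\Psi(\psi\,|\,x)/\pi_\Psi(\psi)$, and $\psi_{RB}(x)=\arg\sup_\psi RB_\Psi(\psi\,|\,x)$. Regular discretization. For each $\lambda>0$, $\{B_\lambda(\psi):\psi\in\Psi(\Theta)\}$ is a partition of $\Psi(\Theta)$ into countably many subsets, where $\psi\in B_\lambda(\psi)$ (so $B_\lambda(\psi')=B_\lambda(\psi)$ whenever $\psi'\in B_\lambda(\psi)$), $\Pi_\Psi(B_\lambda(\psi))>0$, $\sup_{\psi}\mathrm{diam}(B_\lambda(\psi))\to0$ as $\lambda\to0$, and $\Pi_\Psi(B_\lambda(\psi))/\nu_\Psi(B_\lambda(\psi))\to\pi_\Psi(\psi)$ as $\lambda\to0$ for every $\psi$. In each cell a point $\psi_\lambda(\psi)\in B_\lambda(\psi)$ is chosen, the same for all points of the cell, and $\Psi_\lambda=\{\psi_\lambda(\psi):\psi\in\Psi(\Theta)\}$. The discretized prior and posterior on $\Psi_\lambda$ are $\pi_{\Psi,\lambda}(\psi_\lambda(\psi))=\Pi_\Psi(B_\lambda(\psi))$ and $\pi_{\Psi,\lambda}(\psi_\lambda(\psi)\,|\,x)=\Pi_\Psi(B_\lambda(\psi)\,|\,x)$. Loss and Bayes rule. For $\eta>0$, the loss for the discretized problem is $$L_{RB,\lambda,\eta}(\theta,\psi_\lambda(\psi))=\frac{I_{\{\psi_\lambda(\psi)\}^c}(\psi_\lambda(\Psi(\theta)))}{\max(\eta,\pi_{\Psi,\lambda}(\psi_\lambda(\Psi(\theta))))},$$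 where $I_A$ is the indicator function of $A$. A Bayes rule $\delta_{\lambda,\eta}$ for the discretized problem has value $\delta_{\lambda,\eta}(x)\in\Psi_\lambda$ minimizing over $d\in\Psi_\lambda$, for each $x$, the posterior expected loss $\int_\Theta L_{RB,\lambda,\eta}(\theta,d)\,\Pi(d\theta\,|\,x)$.
   Formalization: "η(λ)↓0" is taken as η(λ)>0 with η(λ)→0 as λ→0, without monotonicity in λ: for a regular discretization whose cells vary irregularly with λ, no monotone η works. *)

theory Defs
  imports "HOL-Probability.Probability"
begin

definition vol :: "'a::euclidean_space set \<Rightarrow> 'a measure" where
  "vol S = restrict_space lborel S"

definition statistical_model ::
  "'b::euclidean_space set \<Rightarrow> 'a::euclidean_space set \<Rightarrow> ('b \<Rightarrow> 'a \<Rightarrow> real) \<Rightarrow> bool" where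
  "statistical_model X \<Theta> f \<longleftrightarrow>
     open X \<and> open \<Theta> \<and>
     (\<forall>x\<in>X. \<forall>\<theta>\<in>\<Theta>. 0 \<le> f x \<theta>) \<and>
     (\<lambda>(x, \<theta>). f x \<theta>) \<in> borel_measurable (vol X \<Otimes>\<^sub>M vol \<Theta>) \<and>
     (\<forall>\<theta>\<in>\<Theta>. prob_space (density (vol X) (\<lambda>x. ennreal (f x \<theta>))))"

definition prior :: "'a::euclidean_space set \<Rightarrow> ('a \<Rightarrow> real) \<Rightarrow> 'a measure" where
  "prior \<Theta> p = density (vol \<Theta>) (\<lambda>\<theta>. ennreal (p \<theta>))"

definition proper_prior_density :: "'a::euclidean_space set \<Rightarrow> ('a \<Rightarrow> real) \<Rightarrow> bool" where
  "proper_prior_density \<Theta> p \<longleftrightarrow>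
     p \<in> borel_measurable (vol \<Theta>) \<and> (\<forall>\<theta>\<in>\<Theta>. 0 \<le> p \<theta>) \<and> prob_space (prior \<Theta> p)"

definition prior_predictive ::
  "'a::euclidean_space set \<Rightarrow> ('a \<Rightarrow> real) \<Rightarrow> ('b \<Rightarrow> 'a \<Rightarrow> real) \<Rightarrow> 'b \<Rightarrow> real" where
  "prior_predictive \<Theta> p f x = (\<integral>\<theta>. f x \<theta> \<partial>prior \<Theta> p)"

text \<open>The data points at which the posterior is defined.  The Bochner integral is 0 where
  the nonnegative integrand is not integrable, so this is the set where the prior
  predictive density is positive and finite.\<close>

definition regular_data ::
  "'b set \<Rightarrow> 'a::euclidean_space set \<Rightarrow> ('a \<Rightarrow> real) \<Rightarrow> ('b \<Rightarrow> 'a \<Rightarrow> real) \<Rightarrow> 'b set" where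
  "regular_data X \<Theta> p f = {x \<in> X. 0 < prior_predictive \<Theta> p f x}"

definition posterior ::
  "'a::euclidean_space set \<Rightarrow> ('a \<Rightarrow> real) \<Rightarrow> ('b \<Rightarrow> 'a \<Rightarrow> real) \<Rightarrow> 'b \<Rightarrow> 'a measure" where
  "posterior \<Theta> p f x =
     density (vol \<Theta>) (\<lambda>\<theta>. ennreal (p \<theta> * f x \<theta> / prior_predictive \<Theta> p f x))"

definition marginal_prior ::
  "'a::euclidean_space set \<Rightarrow> ('a \<Rightarrow> real) \<Rightarrow> ('a \<Rightarrow> 'c::euclidean_space) \<Rightarrow> 'c measure" where
  "marginal_prior \<Theta> p \<Psi> = distr (prior \<Theta> p) (vol (\<Psi> ` \<Theta>)) \<Psi>"

definition relative_belief_ratio ::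
  "('c \<Rightarrow> real) \<Rightarrow> ('b \<Rightarrow> 'c \<Rightarrow> real) \<Rightarrow> 'b \<Rightarrow> 'c \<Rightarrow> real" where
  "relative_belief_ratio pPsi pPost x \<psi> = pPost x \<psi> / pPsi \<psi>"

text \<open>Extended-valued, because the library's real-valued diameter is meaningless on
  unbounded sets.\<close>

definition ediameter :: "'c::metric_space set \<Rightarrow> ennreal" where
  "ediameter A = (SUP (y, z) \<in> A \<times> A. ennreal (dist y z))"

text \<open>Here \<open>S\<close> is the range of the parameter of interest, \<open>P\<close> the marginal prior on it and
  \<open>pPsi\<close> the density of \<open>P\<close>; \<open>B l \<psi>\<close> is the cell containing \<open>\<psi>\<close> at level \<open>l\<close>.\<close>

definition regular_discretization ::
  "'c::euclidean_space set \<Rightarrow> 'c measure \<Rightarrow> ('c \<Rightarrow> real) \<Rightarrow> (real \<Rightarrow> 'c \<Rightarrow> 'c set) \<Rightarrow> bool" where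
  "regular_discretization S P pPsi B \<longleftrightarrow>
     (\<forall>l>0. partition_on S (B l ` S) \<and> countable (B l ` S)) \<and>
     (\<forall>l>0. \<forall>\<psi>\<in>S. \<psi> \<in> B l \<psi> \<and> B l \<psi> \<in> sets (vol S) \<and> 0 < measure P (B l \<psi>)) \<and>
     ((\<lambda>l. SUP \<psi>\<in>S. ediameter (B l \<psi>)) \<longlongrightarrow> 0) (at_right 0) \<and>
     (\<forall>\<psi>\<in>S. ((\<lambda>l. measure P (B l \<psi>) / measure (vol S) (B l \<psi>)) \<longlongrightarrow> pPsi \<psi>) (at_right 0))"

definition cell_points ::
  "'c set \<Rightarrow> (real \<Rightarrow> 'c \<Rightarrow> 'c set) \<Rightarrow> (real \<Rightarrow> 'c \<Rightarrow> 'c) \<Rightarrow> bool" where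
  "cell_points S B pt \<longleftrightarrow>
     (\<forall>l>0. \<forall>\<psi>\<in>S. pt l \<psi> \<in> B l \<psi> \<and> (\<forall>\<psi>'\<in>B l \<psi>. pt l \<psi>' = pt l \<psi>))"

text \<open>The argument \<open>d\<close> is a chosen cell point \<open>pt l \<psi>\<close>, and then \<open>B l d = B l \<psi>\<close>.\<close>

definition discretized_prior ::
  "'c measure \<Rightarrow> (real \<Rightarrow> 'c \<Rightarrow> 'c set) \<Rightarrow> real \<Rightarrow> 'c \<Rightarrow> real" where
  "discretized_prior P B l d = measure P (B l d)"

definition RB_loss ::
  "'a::euclidean_space set \<Rightarrow> ('a \<Rightarrow> real) \<Rightarrow> ('a \<Rightarrow> 'c::euclidean_space) \<Rightarrow>
   (real \<Rightarrow> 'c \<Rightarrow> 'c set) \<Rightarrow> (real \<Rightarrow> 'c \<Rightarrow> 'c) \<Rightarrow> real \<Rightarrow> real \<Rightarrow> 'a \<Rightarrow> 'c \<Rightarrow> real" where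
  "RB_loss \<Theta> p \<Psi> B pt l \<eta> \<theta> d =
     indicator (- {d}) (pt l (\<Psi> \<theta>)) /
     max \<eta> (discretized_prior (marginal_prior \<Theta> p \<Psi>) B l (pt l (\<Psi> \<theta>)))"

definition posterior_expected_loss ::
  "'a::euclidean_space set \<Rightarrow> ('a \<Rightarrow> real) \<Rightarrow> ('b \<Rightarrow> 'a \<Rightarrow> real) \<Rightarrow> ('a \<Rightarrow> 'c::euclidean_space) \<Rightarrow>
   (real \<Rightarrow> 'c \<Rightarrow> 'c set) \<Rightarrow> (real \<Rightarrow> 'c \<Rightarrow> 'c) \<Rightarrow> real \<Rightarrow> real \<Rightarrow> 'b \<Rightarrow> 'c \<Rightarrow> real" where
  "posterior_expected_loss \<Theta> p f \<Psi> B pt l \<eta> x d =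
     (\<integral>\<theta>. RB_loss \<Theta> p \<Psi> B pt l \<eta> \<theta> d \<partial>posterior \<Theta> p f x)"

definition bayes_rule ::
  "'b set \<Rightarrow> 'a::euclidean_space set \<Rightarrow> ('a \<Rightarrow> real) \<Rightarrow> ('b \<Rightarrow> 'a \<Rightarrow> real) \<Rightarrow>
   ('a \<Rightarrow> 'c::euclidean_space) \<Rightarrow> (real \<Rightarrow> 'c \<Rightarrow> 'c set) \<Rightarrow> (real \<Rightarrow> 'c \<Rightarrow> 'c) \<Rightarrow>
   real \<Rightarrow> real \<Rightarrow> ('b \<Rightarrow> 'c) \<Rightarrow> bool" where
  "bayes_rule X \<Theta> p f \<Psi> B pt l \<eta> \<delta> \<longleftrightarrow>
     (\<forall>x\<in>regular_data X \<Theta> p f.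
        is_arg_min (posterior_expected_loss \<Theta> p f \<Psi> B pt l \<eta> x)
          (\<lambda>d. d \<in> pt l ` \<Psi> ` \<Theta>) (\<delta> x))"

end

theory Submission
  imports Defs
begin

text \<open>
  Why the theorem holds.  Since the loss is \<open>1 / max \<eta> (prior mass of the true cell)\<close> except when
  the true cell is guessed, the posterior expected loss of a cell point is a constant minus the
  posterior mass of its cell divided by \<open>max \<eta> (prior mass)\<close>.  A Bayes rule therefore picks a
  cell that maximizes this truncated cell ratio.  The truncation at \<open>\<eta> > 0\<close> guarantees that a
  maximizing cell exists (lemma \<open>bounded_sums_attain_max\<close>): the posterior masses are summable,
  so only finitely many cells have a ratio above any given positive level.

  Convergence compares two kinds of cells.  By the separation hypothesis the relative belief ratio
  is bounded by some \<open>t1\<close> outside a ball around \<open>\<psi>\<^sub>R\<^sub>B\<close>, and by continuity it exceeds some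
  \<open>t2 > t1\<close> in a neighbourhood of \<open>\<psi>\<^sub>R\<^sub>B\<close>.  Integrating these pointwise bounds over a cell (lemma \<open>density_measure_le\<close>)
  shows that a cell far from \<open>\<psi>\<^sub>R\<^sub>B\<close> has truncated ratio at most \<open>t1\<close>, whereas a cell inside
  the neighbourhood has truncated ratio at least \<open>t2\<close>, provided that its prior mass is not
  below \<open>\<eta>\<close>.  Thus a Bayes rule must stay close to \<open>\<psi>\<^sub>R\<^sub>B\<close> as soon as one such cell exists.

  The delicate point is the choice of \<open>\<eta>(\<lambda>)\<close>, which must not depend on the data.  The prior mass
  of the cell containing \<open>\<psi>\<^sub>R\<^sub>B(x)\<close> may tend to \<open>0\<close> at a rate that depends on \<open>x\<close>, and no single
  function lies below uncountably many given positive functions near \<open>0\<close> in general.  However,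
  the cell to compare with need not contain \<open>\<psi>\<^sub>R\<^sub>B(x)\<close>; any cell nearby will do.  So it
  suffices that \<open>\<eta>(\<lambda>)\<close> is eventually below the prior mass of the cell of each point of a
  countable dense set, and this is achieved by a diagonal construction
  (lemma \<open>positive_function_eventually_below\<close>).
\<close>

section \<open>Analytic preliminaries\<close>

text \<open>The diagonal construction: near \<open>0\<close> only the first \<open>1 / l\<close> functions are taken into account,
  so the minimum is over a finite set and remains positive.\<close>

lemma positive_function_eventually_below:
  fixes a :: "nat \<Rightarrow> real \<Rightarrow> real"
  assumes pos: "\<And>n l. l > 0 \<Longrightarrow> 0 < a n l"
  obtains \<eta> :: "real \<Rightarrow> real" where
    "\<And>l. l > 0 \<Longrightarrow> 0 < \<eta> l" "(\<eta> \<longlongrightarrow> 0) (at_right 0)"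
    "\<And>n. eventually (\<lambda>l. \<eta> l \<le> a n l) (at_right 0)"
proof
  define A where "A l = insert l ((\<lambda>n. a n l) ` {n. real n \<le> 1 / l})" for l
  define \<eta> where "\<eta> l = Min (A l)" for l
  have fin: "finite (A l)" for l
  proof -
    have "{n. real n \<le> 1 / l} \<subseteq> {..nat \<lfloor>1 / l\<rfloor>}"
      by (auto simp: le_nat_floor)
    then show ?thesis
      unfolding A_def by (meson finite_atMost finite_imageI finite_insert finite_subset)
  qed
  show \<eta>_pos: "0 < \<eta> l" if "l > 0" for l
    using that pos fin[of l] by (auto simp: \<eta>_def A_def Min_gr_iff)
  have "\<eta> l \<le> l" for l
    using fin[of l] by (auto simp: \<eta>_def A_def intro!: Min_le)
  moreover have "((\<lambda>l::real. l) \<longlongrightarrow> 0) (at_right 0)"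
    by (rule tendsto_ident_at)
  ultimately show "(\<eta> \<longlongrightarrow> 0) (at_right 0)"
    using \<eta>_pos
    by (intro tendsto_sandwich[of "\<lambda>_. 0" \<eta> "at_right 0" "\<lambda>l. l"])
       (auto intro: eventually_mono[OF eventually_at_right_less] less_imp_le)
  show "eventually (\<lambda>l. \<eta> l \<le> a n l) (at_right 0)" for n
  proof -
    have "eventually (\<lambda>l::real. l \<in> {0<..<1 / (real n + 1)}) (at_right 0)"
      by (rule eventually_at_right_real) simp
    then show ?thesis
    proof eventually_elim
      case (elim l)
      then have "(real n + 1) * l < 1"
        by (simp add: field_simps)
      with elim have "real n \<le> 1 / l"
        by (simp add: field_simps)
      then show ?case
        using fin[of l] unfolding \<eta>_def by (intro Min_le) (auto simp: A_def)
    qed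
  qed
qed

text \<open>If some value is positive, only finitely many others can be as large, because the sums are
  bounded; the maximum is then attained among these.\<close>

lemma bounded_sums_attain_max:
  fixes g :: "'i \<Rightarrow> real"
  assumes "D \<noteq> {}" and nonneg: "\<And>d. d \<in> D \<Longrightarrow> 0 \<le> g d"
    and bound: "\<And>F. finite F \<Longrightarrow> F \<subseteq> D \<Longrightarrow> sum g F \<le> K"
  shows "\<exists>d\<in>D. \<forall>e\<in>D. g e \<le> g d"
proof (cases "\<exists>d\<in>D. 0 < g d")
  case False
  then have "g d = 0" if "d \<in> D" for d
    using that nonneg[of d] by force
  then show ?thesis using assms(1) by auto
next
  case True
  then obtain d where d: "d \<in> D" "0 < g d" by blast
  define E where "E = {e \<in> D. g d \<le> g e}"
  have "finite E"
  proof (rule ccontr)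
    assume "infinite E"
    then obtain F where F: "F \<subseteq> E" "finite F" "card F = nat \<lfloor>K / g d\<rfloor> + 1"
      using infinite_arbitrarily_large by metis
    have "K / g d < real (card F)"
      using F(3) by (simp; linarith)
    then have "K < real (card F) * g d"
      using d(2) by (simp add: pos_divide_less_eq)
    also have "\<dots> \<le> sum g F"
      using F(1) by (intro sum_bounded_below) (auto simp: E_def)
    also have "\<dots> \<le> K"
      using F by (intro bound) (auto simp: E_def)
    finally show False by simp
  qed
  moreover have "d \<in> E" using d by (simp add: E_def)
  ultimately have "Max (g ` E) \<in> g ` E" and le: "\<And>e. e \<in> E \<Longrightarrow> g e \<le> Max (g ` E)"
    by (auto intro!: Max_in)
  then obtain m where m: "m \<in> E" "g m = Max (g ` E)" by auto
  have "g e \<le> g m" if "e \<in> D" for e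
    using le[of e] le[OF \<open>d \<in> E\<close>] m that by (cases "g d \<le> g e") (auto simp: E_def)
  moreover have "m \<in> D" using m by (simp add: E_def)
  ultimately show ?thesis by blast
qed

text \<open>Passes a pointwise bound on a ratio of densities to the ratio of the masses of a cell.  With
  the two factors, one statement covers upper and lower bounds; writing the masses as real
  integrals allows any sign of \<open>s\<close> and \<open>t\<close>.\<close>

lemma density_measure_le:
  fixes f g :: "'a \<Rightarrow> real"
  assumes "finite_measure (density N (\<lambda>y. ennreal (f y)))"
    and "finite_measure (density N (\<lambda>y. ennreal (g y)))"
    and meas: "f \<in> borel_measurable N" "g \<in> borel_measurable N"
    and nonneg: "\<And>y. y \<in> space N \<Longrightarrow> 0 \<le> f y" "\<And>y. y \<in> space N \<Longrightarrow> 0 \<le> g y"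
    and C: "C \<in> sets N" and le: "\<And>y. y \<in> C \<Longrightarrow> s * f y \<le> t * g y"
  shows "s * measure (density N (\<lambda>y. ennreal (f y))) C \<le> t * measure (density N (\<lambda>y. ennreal (g y))) C"
proof -
  have mass: "integrable N (\<lambda>y. h y * indicator C y) \<and>
      measure (density N (\<lambda>y. ennreal (h y))) C = (\<integral>y. h y * indicator C y \<partial>N)"
    if fin: "finite_measure (density N (\<lambda>y. ennreal (h y)))"
      and h: "h \<in> borel_measurable N" "\<And>y. y \<in> space N \<Longrightarrow> 0 \<le> h y" for h :: "'a \<Rightarrow> real"
  proof -
    interpret finite_measure "density N (\<lambda>y. ennreal (h y))" by (rule fin)
    have "integrable (density N (\<lambda>y. ennreal (h y))) (indicator C :: 'a \<Rightarrow> real)"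
      using C by (intro integrable_real_indicator) (auto simp: emeasure_eq_measure)
    moreover have "measure (density N (\<lambda>y. ennreal (h y))) C =
        (\<integral>y. indicator C y \<partial>density N (\<lambda>y. ennreal (h y)))"
      using C sets.sets_into_space[OF C] by (simp add: Int_absorb1 Int_absorb2)
    moreover have "(\<integral>y. indicator C y \<partial>density N (\<lambda>y. ennreal (h y))) = (\<integral>y. h y * indicator C y \<partial>N)"
      using C h by (intro integral_real_density) auto
    ultimately show ?thesis
      using C h by (simp add: integrable_real_density)
  qed
  have "s * (\<integral>y. f y * indicator C y \<partial>N) \<le> t * (\<integral>y. g y * indicator C y \<partial>N)"
    unfolding integral_mult_right_zero[symmetric]
  proof (rule integral_mono)
    show "integrable N (\<lambda>y. s * (f y * indicator C y))" "integrable N (\<lambda>y. t * (g y * indicator C y))"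
      using mass[OF assms(1) meas(1) nonneg(1)] mass[OF assms(2) meas(2) nonneg(2)] by auto
    show "s * (f y * indicator C y) \<le> t * (g y * indicator C y)" for y
      using le[of y] by (auto simp: indicator_def)
  qed
  then show ?thesis
    using mass[OF assms(1) meas(1) nonneg(1)] mass[OF assms(2) meas(2) nonneg(2)] by simp
qed

section \<open>Cells of a discretization\<close>

locale discretization =
  fixes S :: "'c::euclidean_space set" and P :: "'c measure" and pPsi :: "'c \<Rightarrow> real"
    and B :: "real \<Rightarrow> 'c \<Rightarrow> 'c set" and pt :: "real \<Rightarrow> 'c \<Rightarrow> 'c"
  assumes regular: "regular_discretization S P pPsi B"
    and cell_points: "cell_points S B pt"
begin

lemma cell_facts:
  assumes "l > 0" "\<psi> \<in> S"
  shows "\<psi> \<in> B l \<psi>" "B l \<psi> \<in> sets (vol S)" "0 < measure P (B l \<psi>)" "B l \<psi> \<subseteq> S"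
    "pt l \<psi> \<in> B l \<psi>" "\<And>\<psi>'. \<psi>' \<in> B l \<psi> \<Longrightarrow> pt l \<psi>' = pt l \<psi>"
    "\<And>\<psi>'. \<psi>' \<in> B l \<psi> \<Longrightarrow> B l \<psi>' = B l \<psi>"
proof -
  have part: "partition_on S (B l ` S)"
    using regular assms by (simp add: regular_discretization_def)
  show sub: "B l \<psi> \<subseteq> S"
    using partition_onD1[OF part] assms by blast
  show "\<psi> \<in> B l \<psi>" "B l \<psi> \<in> sets (vol S)" "0 < measure P (B l \<psi>)"
    using regular assms by (simp_all add: regular_discretization_def)
  show "pt l \<psi> \<in> B l \<psi>" "\<And>\<psi>'. \<psi>' \<in> B l \<psi> \<Longrightarrow> pt l \<psi>' = pt l \<psi>"
    using cell_points assms by (auto simp: cell_points_def)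
  show "B l \<psi>' = B l \<psi>" if "\<psi>' \<in> B l \<psi>" for \<psi>'
  proof -
    have "\<psi>' \<in> S" using that sub by auto
    then have "\<psi>' \<in> B l \<psi>'"
      using regular assms by (simp add: regular_discretization_def)
    then show ?thesis
      using partition_onD2[OF part] that \<open>\<psi>' \<in> S\<close> assms
      by (auto simp: disjoint_def)
  qed
qed

lemma pt_idem:
  assumes "l > 0" "d \<in> pt l ` S"
  shows "d \<in> S" "pt l d = d"
proof -
  obtain \<psi> where \<psi>: "\<psi> \<in> S" "d = pt l \<psi>"
    using assms(2) by auto
  note cell = cell_facts[OF assms(1) \<psi>(1)]
  show "d \<in> S" using cell(4,5) \<psi>(2) by auto
  show "pt l d = d" using cell(6)[OF cell(5)] \<psi>(2) by simp
qed

lemma cell_of_point: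
  assumes "l > 0" "\<psi> \<in> S"
  shows "B l (pt l \<psi>) = B l \<psi>"
  by (rule cell_facts(7)[OF assms cell_facts(5)[OF assms]])

lemma cell_eq_fibre:
  assumes "l > 0" "d \<in> pt l ` S"
  shows "B l d = {\<psi> \<in> S. pt l \<psi> = d}"
proof -
  note d = pt_idem[OF assms]
  have "\<psi> \<in> B l d" if "\<psi> \<in> S" "pt l \<psi> = d" for \<psi>
    using cell_facts(1)[OF assms(1) that(1)] cell_of_point[OF assms(1) that(1)] that(2) by simp
  moreover have "\<psi> \<in> S \<and> pt l \<psi> = d" if "\<psi> \<in> B l d" for \<psi>
    using cell_facts(4)[OF assms(1) d(1)] cell_facts(6)[OF assms(1) d(1) that] that d(2) by auto
  ultimately show ?thesis by blast
qed

lemma countable_points: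
  assumes "l > 0"
  shows "countable (pt l ` S)"
proof (rule countable_image_inj_on)
  show "countable (B l ` pt l ` S)"
  proof (rule countable_subset)
    show "B l ` pt l ` S \<subseteq> B l ` S"
      using pt_idem(1)[OF assms] by blast
    show "countable (B l ` S)"
      using regular assms by (simp add: regular_discretization_def)
  qed
  show "inj_on (B l) (pt l ` S)"
  proof (rule inj_onI)
    fix d e assume d: "d \<in> pt l ` S" and e: "e \<in> pt l ` S" and "B l d = B l e"
    then have "d \<in> B l e"
      using cell_facts(1)[OF assms pt_idem(1)[OF assms d]] by simp
    then show "d = e"
      using cell_eq_fibre[OF assms e] pt_idem(2)[OF assms d] by simp
  qed
qed

text \<open>The fibres of \<open>pt l\<close> are cells and there are countably many of them, so every function of
  the cell point is measurable, the weight of the loss in particular.\<close>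

lemma measurable_pt:
  assumes "l > 0" "space Q = S" "sets Q = sets (vol S)"
  shows "pt l \<in> measurable Q (count_space (pt l ` S))"
proof -
  have "pt l -` {d} \<inter> space Q \<in> sets Q" if "d \<in> pt l ` S" for d
  proof -
    have "pt l -` {d} \<inter> space Q = B l d"
      using cell_eq_fibre[OF assms(1) that] assms(2) by auto
    then show ?thesis
      using cell_facts(2)[OF assms(1) pt_idem(1)[OF assms(1) that]] assms(3) by simp
  qed
  moreover have "pt l \<in> space Q \<rightarrow> pt l ` S"
    using assms(2) by auto
  ultimately show ?thesis
    unfolding measurable_count_space_eq_countable[OF countable_points[OF assms(1)]] by blast
qed

lemma eventually_small_cells:
  assumes "e > 0"
  shows "eventually (\<lambda>l. \<forall>\<psi>\<in>S. \<forall>y\<in>B l \<psi>. dist \<psi> y < e) (at_right 0)"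
proof -
  have "((\<lambda>l. SUP \<psi>\<in>S. ediameter (B l \<psi>)) \<longlongrightarrow> 0) (at_right 0)"
    using regular by (simp add: regular_discretization_def)
  then have "eventually (\<lambda>l. (SUP \<psi>\<in>S. ediameter (B l \<psi>)) < ennreal e) (at_right 0)"
    using assms by (intro order_tendstoD) auto
  moreover have "eventually (\<lambda>l::real. l > 0) (at_right 0)"
    by (rule eventually_at_right_less)
  ultimately show ?thesis
  proof eventually_elim
    case (elim l)
    show ?case
    proof (intro ballI)
      fix \<psi> y assume y: "\<psi> \<in> S" "y \<in> B l \<psi>"
      have "ennreal (dist \<psi> y) \<le> ediameter (B l \<psi>)"
        unfolding ediameter_def
        using y cell_facts(1)[OF elim(2) y(1)] by (intro SUP_upper2[of "(\<psi>, y)"]) auto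
      also have "\<dots> \<le> (SUP \<psi>\<in>S. ediameter (B l \<psi>))"
        using y(1) by (rule SUP_upper)
      also note elim(1)
      finally show "dist \<psi> y < e"
        by (simp add: ennreal_less_iff)
    qed
  qed
qed

section \<open>Bayes rules maximize the truncated cell ratio\<close>

definition truncated_ratio :: "'c measure \<Rightarrow> real \<Rightarrow> real \<Rightarrow> 'c \<Rightarrow> real" where
  "truncated_ratio Q \<eta> l d = measure Q (B l d) / max \<eta> (measure P (B l d))"

text \<open>Deciding for \<open>d\<close> saves the loss on the cell of \<open>d\<close> and only there; on that cell the weight
  of the loss is constant.  As the weights are bounded by \<open>1 / \<eta>\<close>, the remaining integral, which
  does not depend on \<open>d\<close>, is finite and the two parts can be separated.\<close>

lemma expected_loss_eq:
  assumes "l > 0" "\<eta> > 0" "finite_measure Q" and Q: "space Q = S" "sets Q = sets (vol S)"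
    and d: "d \<in> pt l ` S"
  shows "(\<integral>\<psi>. indicator (- {d}) (pt l \<psi>) / max \<eta> (measure P (B l (pt l \<psi>))) \<partial>Q) =
    (\<integral>\<psi>. 1 / max \<eta> (measure P (B l (pt l \<psi>))) \<partial>Q) - truncated_ratio Q \<eta> l d"
proof -
  interpret finite_measure Q by fact
  let ?w = "\<lambda>d. 1 / max \<eta> (measure P (B l d))"
  have cell: "B l d \<in> sets Q"
    using cell_facts(2)[OF assms(1) pt_idem(1)[OF assms(1) d]] Q(2) by simp
  have "(\<lambda>\<psi>. ?w (pt l \<psi>)) \<in> borel_measurable Q"
    by (rule measurable_compose[OF measurable_pt[OF assms(1) Q]]) simp
  moreover have "AE \<psi> in Q. norm (?w (pt l \<psi>)) \<le> 1 / \<eta>"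
    using assms(2) by (auto intro!: AE_I2 frac_le)
  ultimately have int_w: "integrable Q (\<lambda>\<psi>. ?w (pt l \<psi>))"
    by (rule integrable_const_bound[rotated])
  have "(\<integral>\<psi>. indicator (- {d}) (pt l \<psi>) / max \<eta> (measure P (B l (pt l \<psi>))) \<partial>Q) =
    (\<integral>\<psi>. ?w (pt l \<psi>) - ?w d * indicator (B l d) \<psi> \<partial>Q)"
    using cell_eq_fibre[OF assms(1) d] Q
    by (intro Bochner_Integration.integral_cong) (auto simp: indicator_def)
  also have "\<dots> = (\<integral>\<psi>. ?w (pt l \<psi>) \<partial>Q) - (\<integral>\<psi>. ?w d * indicator (B l d) \<psi> \<partial>Q)"
    using int_w cell
    by (intro Bochner_Integration.integral_diff integrable_mult_right integrable_real_indicator)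
       (auto simp: emeasure_eq_measure)
  also have "(\<integral>\<psi>. ?w d * indicator (B l d) \<psi> \<partial>Q) = truncated_ratio Q \<eta> l d"
    using sets.sets_into_space[OF cell] by (simp add: truncated_ratio_def Int_absorb2)
  finally show ?thesis .
qed

lemma truncated_ratio_attains_max:
  assumes "l > 0" "\<eta> > 0" "finite_measure Q" "sets Q = sets (vol S)" "S \<noteq> {}"
  shows "\<exists>d\<in>pt l ` S. \<forall>e\<in>pt l ` S. truncated_ratio Q \<eta> l e \<le> truncated_ratio Q \<eta> l d"
proof (rule bounded_sums_attain_max)
  interpret finite_measure Q by fact
  show "pt l ` S \<noteq> {}" using assms by simp
  show "0 \<le> truncated_ratio Q \<eta> l d" for d
    using assms(2) by (auto simp: truncated_ratio_def le_max_iff_disj)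
  fix F assume F: "finite F" "F \<subseteq> pt l ` S"
  have "disjoint_family_on (B l) F"
    unfolding disjoint_family_on_def
  proof (intro ballI impI)
    fix d e assume "d \<in> F" "e \<in> F" and ne: "d \<noteq> e"
    then have "d \<in> pt l ` S" "e \<in> pt l ` S"
      using F(2) by auto
    then show "B l d \<inter> B l e = {}"
      using ne by (auto simp: cell_eq_fibre[OF assms(1)])
  qed
  moreover have sets: "B l ` F \<subseteq> sets Q"
    using F(2) cell_facts(2)[OF assms(1) pt_idem(1)[OF assms(1)]] assms(4) by auto
  ultimately have "(\<Sum>d\<in>F. measure Q (B l d)) = measure Q (\<Union>d\<in>F. B l d)"
    using F(1) by (intro finite_measure_finite_Union[symmetric]) auto
  also have "\<dots> \<le> measure Q (space Q)"
    by (rule bounded_measure)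
  finally have "(\<Sum>d\<in>F. measure Q (B l d) / \<eta>) \<le> measure Q (space Q) / \<eta>"
    using assms(2) by (simp add: sum_divide_distrib[symmetric] divide_right_mono)
  moreover have "(\<Sum>d\<in>F. truncated_ratio Q \<eta> l d) \<le> (\<Sum>d\<in>F. measure Q (B l d) / \<eta>)"
    unfolding truncated_ratio_def using assms(2) by (intro sum_mono divide_left_mono) auto
  ultimately show "(\<Sum>d\<in>F. truncated_ratio Q \<eta> l d) \<le> measure Q (space Q) / \<eta>"
    by linarith
qed

section \<open>Convergence of the maximizing cell points\<close>

text \<open>Far from \<open>z\<close> the truncated ratio is at most \<open>t1\<close>, since truncation only lowers the ratio
  of posterior to prior mass.  A point \<open>q n\<close> close to \<open>z\<close> provides a competing cell whose
  ratio exceeds \<open>t1\<close>, because there the truncation is eventually inactive.\<close>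

lemma maximizers_converge:
  fixes h :: "'c \<Rightarrow> real" and q :: "nat \<Rightarrow> 'c"
  assumes S: "open S" "z \<in> S"
    and P: "P = density (vol S) (\<lambda>\<psi>. ennreal (pPsi \<psi>))" "finite_measure P"
    and Q: "Q = density (vol S) (\<lambda>\<psi>. ennreal (h \<psi>))" "finite_measure Q"
    and meas: "pPsi \<in> borel_measurable (vol S)" "h \<in> borel_measurable (vol S)"
    and pos: "\<And>\<psi>. \<psi> \<in> S \<Longrightarrow> 0 < pPsi \<psi>" "\<And>\<psi>. \<psi> \<in> S \<Longrightarrow> 0 \<le> h \<psi>"
    and cont: "continuous_on S pPsi" "continuous_on S h"
    and separated: "\<And>\<epsilon>. \<epsilon> > 0 \<Longrightarrow>
      \<exists>t < h z / pPsi z. \<forall>\<psi>\<in>S. \<epsilon> \<le> dist \<psi> z \<longrightarrow> h \<psi> / pPsi \<psi> \<le> t"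
    and q: "\<And>n. q n \<in> S" "\<And>U. open U \<Longrightarrow> U \<noteq> {} \<Longrightarrow> U \<subseteq> S \<Longrightarrow> \<exists>n. q n \<in> U"
    and \<eta>: "\<And>n. eventually (\<lambda>l. \<eta> l \<le> measure P (B l (q n))) (at_right 0)"
    and d: "\<And>l. l > 0 \<Longrightarrow> d l \<in> pt l ` S"
    and max: "\<And>l e. l > 0 \<Longrightarrow> e \<in> pt l ` S \<Longrightarrow>
      truncated_ratio Q (\<eta> l) l e \<le> truncated_ratio Q (\<eta> l) l (d l)"
  shows "(d \<longlongrightarrow> z) (at_right 0)"
proof (rule tendstoI)
  fix \<epsilon> :: real assume "\<epsilon> > 0"
  then obtain t1 where t1: "t1 < h z / pPsi z"
      and far: "\<And>\<psi>. \<psi> \<in> S \<Longrightarrow> \<epsilon> / 2 \<le> dist \<psi> z \<Longrightarrow> h \<psi> / pPsi \<psi> \<le> t1"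
    using separated[of "\<epsilon> / 2"] by auto
  obtain t2 where t2: "t1 < t2" "t2 < h z / pPsi z"
    using dense t1 by blast
  have "continuous_on S (\<lambda>\<psi>. h \<psi> / pPsi \<psi>)"
    using cont pos(1) by (intro continuous_intros) force+
  then have "isCont (\<lambda>\<psi>. h \<psi> / pPsi \<psi>) z"
    using S continuous_on_eq_continuous_at by blast
  then have "((\<lambda>\<psi>. h \<psi> / pPsi \<psi>) \<longlongrightarrow> h z / pPsi z) (nhds z)"
    using tendsto_at_iff_tendsto_nhds[of "\<lambda>\<psi>. h \<psi> / pPsi \<psi>" z] by (simp add: isCont_def)
  then have "eventually (\<lambda>\<psi>. t2 < h \<psi> / pPsi \<psi>) (nhds z)"
    using t2(2) by (rule order_tendstoD(1))
  moreover have "eventually (\<lambda>\<psi>. \<psi> \<in> S) (nhds z)"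
    using S by (rule eventually_nhds_in_open)
  ultimately have "eventually (\<lambda>\<psi>. t2 < h \<psi> / pPsi \<psi> \<and> \<psi> \<in> S) (nhds z)"
    by (rule eventually_conj)
  then obtain \<rho> where \<rho>: "\<rho> > 0" and near: "\<And>\<psi>. dist \<psi> z < \<rho> \<Longrightarrow> t2 < h \<psi> / pPsi \<psi> \<and> \<psi> \<in> S"
    unfolding eventually_nhds_metric by blast
  obtain n where n: "q n \<in> ball z (\<rho> / 2)"
    using q(2)[of "ball z (\<rho> / 2)"] near \<rho> by (force simp: dist_commute)
  have sp: "space (vol S) = S" by (simp add: vol_def space_restrict_space)
  have "eventually (\<lambda>l::real. l > 0) (at_right 0)"
    by (rule eventually_at_right_less)
  moreover have "eventually (\<lambda>l. \<forall>\<psi>\<in>S. \<forall>y\<in>B l \<psi>. dist \<psi> y < min (\<epsilon> / 2) (\<rho> / 2)) (at_right 0)"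
    using \<open>\<epsilon> > 0\<close> \<rho> by (intro eventually_small_cells) simp
  ultimately show "eventually (\<lambda>l. dist (d l) z < \<epsilon>) (at_right 0)"
    using \<eta>[of n]
  proof eventually_elim
    case (elim l)
    note l = elim(1) and small = elim(2) and \<eta>_le = elim(3)
    note cell = cell_facts[OF l q(1)[of n]]
    have "t2 * pPsi y \<le> 1 * h y" if "y \<in> B l (q n)" for y
    proof -
      have "dist (q n) y < \<rho> / 2" using small q(1) that by auto
      then have "dist y z < \<rho>"
        using n dist_triangle_half_l[of "q n" z \<rho> y]
        by (metis dist_commute dist_triangle_half_r mem_ball)
      then show ?thesis
        using near[of y] pos(1)[of y] by (simp add: field_simps)
    qed
    then have "t2 * measure P (B l (q n)) \<le> 1 * measure Q (B l (q n))"
      using P(2) Q(2) meas pos cell(2) sp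
      by (intro density_measure_le[where N = "vol S" and f = pPsi and g = h, folded P(1) Q(1)]) (auto intro: less_imp_le)
    then have t2_le: "t2 \<le> truncated_ratio Q (\<eta> l) l (pt l (q n))"
      using cell(3) \<eta>_le cell_of_point[OF l q(1)]
      by (simp add: truncated_ratio_def max_def field_simps)
    show "dist (d l) z < \<epsilon>"
    proof (rule ccontr)
      assume not_near: "\<not> dist (d l) z < \<epsilon>"
      have dS: "d l \<in> S" using pt_idem(1) d l by blast
      note dcell = cell_facts[OF l dS]
      have "1 * h y \<le> t1 * pPsi y" if y: "y \<in> B l (d l)" for y
      proof -
        have "dist (d l) y < \<epsilon> / 2" using small dS y by auto
        then have "\<epsilon> / 2 \<le> dist y z"
          using not_near dist_triangle[of "d l" z y] by linarith
        moreover have "y \<in> S" using y dcell(4) by auto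
        ultimately show ?thesis
          using far[of y] pos(1)[of y] by (simp add: field_simps)
      qed
      then have "1 * measure Q (B l (d l)) \<le> t1 * measure P (B l (d l))"
        using P(2) Q(2) meas pos dcell(2) sp
        by (intro density_measure_le[where N = "vol S" and f = h and g = pPsi, folded P(1) Q(1)]) (auto intro: less_imp_le)
      then have "measure Q (B l (d l)) / measure P (B l (d l)) \<le> t1"
        using dcell(3) by (simp add: field_simps)
      moreover have "truncated_ratio Q (\<eta> l) l (d l) \<le> measure Q (B l (d l)) / measure P (B l (d l))"
        unfolding truncated_ratio_def using dcell(3) by (intro divide_left_mono) auto
      ultimately show False
        using max[OF l, of "pt l (q n)"] q(1)[of n] t2_le t2(1) by fastforce
    qed
  qed
qed

end

section \<open>The posterior\<close>

lemma prob_space_posterior: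
  assumes model: "statistical_model X \<Theta> f" and prior: "proper_prior_density \<Theta> p"
    and x: "x \<in> regular_data X \<Theta> p f"
  shows "prob_space (posterior \<Theta> p f x)"
proof
  let ?m = "prior_predictive \<Theta> p f x"
  have p[measurable]: "p \<in> borel_measurable (vol \<Theta>)" and p_nonneg: "\<And>\<theta>. \<theta> \<in> \<Theta> \<Longrightarrow> 0 \<le> p \<theta>"
    using prior by (auto simp: proper_prior_density_def)
  have xX: "x \<in> X" and m: "0 < ?m"
    using x by (auto simp: regular_data_def)
  have space: "space (vol \<Theta>) = \<Theta>" "space (vol X) = X"
    by (simp_all add: vol_def space_restrict_space)
  have "(\<lambda>(x, \<theta>). f x \<theta>) \<in> borel_measurable (vol X \<Otimes>\<^sub>M vol \<Theta>)"
    using model by (simp add: statistical_model_def)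
  then have f[measurable]: "f x \<in> borel_measurable (vol \<Theta>)"
    using measurable_Pair2[of "\<lambda>(x, \<theta>). f x \<theta>" "vol X" "vol \<Theta>" borel x] xX space by simp
  have f_nonneg: "\<And>\<theta>. \<theta> \<in> \<Theta> \<Longrightarrow> 0 \<le> f x \<theta>"
    using model xX by (auto simp: statistical_model_def)
  \<comment> \<open>a nonzero Bochner integral certifies integrability\<close>
  have "integrable (prior \<Theta> p) (f x)"
    using m not_integrable_integral_eq unfolding prior_predictive_def by fastforce
  then have "ennreal ?m = (\<integral>\<^sup>+\<theta>. ennreal (f x \<theta>) \<partial>prior \<Theta> p)"
    unfolding prior_predictive_def
    by (intro nn_integral_eq_integral[symmetric] AE_I2) (auto simp: prior_def space f_nonneg)
  also have "\<dots> = (\<integral>\<^sup>+\<theta>. ennreal (p \<theta> * f x \<theta>) \<partial>vol \<Theta>)"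
    unfolding prior_def
    by (subst nn_integral_density)
       (auto intro!: nn_integral_cong simp: space p_nonneg f_nonneg ennreal_mult)
  finally have total: "(\<integral>\<^sup>+\<theta>. ennreal (p \<theta> * f x \<theta>) \<partial>vol \<Theta>) = ennreal ?m" ..
  have "emeasure (posterior \<Theta> p f x) (space (posterior \<Theta> p f x)) =
      (\<integral>\<^sup>+\<theta>. ennreal (p \<theta> * f x \<theta> / ?m) \<partial>vol \<Theta>)"
    unfolding posterior_def
    by (subst emeasure_density) (auto intro!: nn_integral_cong)
  also have "\<dots> = (\<integral>\<^sup>+\<theta>. ennreal (p \<theta> * f x \<theta>) / ennreal ?m \<partial>vol \<Theta>)"
    using m by (intro nn_integral_cong) (simp add: divide_ennreal space p_nonneg f_nonneg)
  also have "\<dots> = ennreal ?m / ennreal ?m"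
    by (subst nn_integral_divide) (simp_all add: total)
  also have "\<dots> = 1"
    using m by (simp add: divide_ennreal)
  finally show "emeasure (posterior \<Theta> p f x) (space (posterior \<Theta> p f x)) = 1" .
qed

section \<open>Convergence of Bayes rules\<close>

theorem theorem6:
  fixes \<Theta> :: "'a::euclidean_space set"
    and X :: "'b::euclidean_space set"
    and f :: "'b \<Rightarrow> 'a \<Rightarrow> real"
    and p :: "'a \<Rightarrow> real"
    and \<Psi> :: "'a \<Rightarrow> 'c::euclidean_space"
    and pPsi :: "'c \<Rightarrow> real"
    and pPost :: "'b \<Rightarrow> 'c \<Rightarrow> real"
    and psiRB :: "'b \<Rightarrow> 'c"
    and B :: "real \<Rightarrow> 'c \<Rightarrow> 'c set"
    and pt :: "real \<Rightarrow> 'c \<Rightarrow> 'c"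
  assumes model: "statistical_model X \<Theta> f"
    and prior: "proper_prior_density \<Theta> p"
    and range_open: "open (\<Psi> ` \<Theta>)"
    and pPsi_density: "distributed (prior \<Theta> p) (vol (\<Psi> ` \<Theta>)) \<Psi> (\<lambda>\<psi>. ennreal (pPsi \<psi>))"
    and pPsi_pos: "\<forall>\<psi>\<in>\<Psi> ` \<Theta>. 0 < pPsi \<psi>"
    and pPsi_cont: "continuous_on (\<Psi> ` \<Theta>) pPsi"
    and pPost_density: "\<forall>x\<in>regular_data X \<Theta> p f.
          distributed (posterior \<Theta> p f x) (vol (\<Psi> ` \<Theta>)) \<Psi> (\<lambda>\<psi>. ennreal (pPost x \<psi>))"
    and pPost_nonneg: "\<forall>x\<in>regular_data X \<Theta> p f. \<forall>\<psi>\<in>\<Psi> ` \<Theta>. 0 \<le> pPost x \<psi>"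
    and pPost_cont: "\<forall>x\<in>regular_data X \<Theta> p f. continuous_on (\<Psi> ` \<Theta>) (pPost x)"
    and discretization: "regular_discretization (\<Psi> ` \<Theta>) (marginal_prior \<Theta> p \<Psi>) pPsi B"
    and points: "cell_points (\<Psi> ` \<Theta>) B pt"
    and unique_max: "\<forall>x\<in>regular_data X \<Theta> p f. \<forall>\<psi>.
          is_arg_max (relative_belief_ratio pPsi pPost x) (\<lambda>\<psi>. \<psi> \<in> \<Psi> ` \<Theta>) \<psi>
            \<longleftrightarrow> \<psi> = psiRB x"
    and separated: "\<forall>x\<in>regular_data X \<Theta> p f. \<forall>\<epsilon>>0.
          (SUP \<psi>\<in>{\<psi> \<in> \<Psi> ` \<Theta>. norm (\<psi> - psiRB x) \<ge> \<epsilon>}.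
             ereal (relative_belief_ratio pPsi pPost x \<psi>))
            < ereal (relative_belief_ratio pPsi pPost x (psiRB x))"
  shows "\<exists>\<eta> :: real \<Rightarrow> real.
           (\<forall>l>0. 0 < \<eta> l) \<and> (\<eta> \<longlongrightarrow> 0) (at_right 0) \<and>
           (\<forall>l>0. \<exists>\<delta>. bayes_rule X \<Theta> p f \<Psi> B pt l (\<eta> l) \<delta>) \<and>
           (\<forall>\<delta>. (\<forall>l>0. bayes_rule X \<Theta> p f \<Psi> B pt l (\<eta> l) (\<delta> l)) \<longrightarrow>
              (\<forall>x\<in>regular_data X \<Theta> p f. ((\<lambda>l. \<delta> l x) \<longlongrightarrow> psiRB x) (at_right 0)))"
proof -
  let ?S = "\<Psi> ` \<Theta>" and ?P = "marginal_prior \<Theta> p \<Psi>" and ?D = "regular_data X \<Theta> p f"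
  define Q where "Q x = distr (posterior \<Theta> p f x) (vol ?S) \<Psi>" for x
  interpret discretization ?S ?P pPsi B pt
    using discretization points by (rule discretization.intro)
  have space_vol: "space (vol ?S) = ?S"
    by (simp add: vol_def space_restrict_space)
  interpret prior: prob_space "prior \<Theta> p"
    using prior by (simp add: proper_prior_density_def)
  have S_ne: "?S \<noteq> {}"
    using prior.not_empty by (auto simp: prior_def vol_def space_restrict_space)

  have P: "?P = density (vol ?S) (\<lambda>\<psi>. ennreal (pPsi \<psi>))" "finite_measure ?P"
    "pPsi \<in> borel_measurable (vol ?S)"
  proof -
    show "?P = density (vol ?S) (\<lambda>\<psi>. ennreal (pPsi \<psi>))"
      unfolding marginal_prior_def by (rule distributed_distr_eq_density[OF pPsi_density])
    show "finite_measure ?P"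
      unfolding marginal_prior_def
      by (rule prior.finite_measure_distr[OF distributed_measurable[OF pPsi_density]])
    show "pPsi \<in> borel_measurable (vol ?S)"
      using pPsi_pos space_vol
      by (intro distributed_real_measurable[OF _ pPsi_density]) (auto intro: less_imp_le)
  qed
  have Q: "Q x = density (vol ?S) (\<lambda>\<psi>. ennreal (pPost x \<psi>))" "finite_measure (Q x)"
    "pPost x \<in> borel_measurable (vol ?S)" "\<Psi> \<in> measurable (posterior \<Theta> p f x) (vol ?S)"
    if x: "x \<in> ?D" for x
  proof -
    interpret post: prob_space "posterior \<Theta> p f x"
      by (rule prob_space_posterior[OF model prior x])
    note dens = pPost_density[rule_format, OF x]
    show \<Psi>: "\<Psi> \<in> measurable (posterior \<Theta> p f x) (vol ?S)"
      by (rule distributed_measurable[OF dens])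
    show "Q x = density (vol ?S) (\<lambda>\<psi>. ennreal (pPost x \<psi>))"
      unfolding Q_def by (rule distributed_distr_eq_density[OF dens])
    show "finite_measure (Q x)"
      unfolding Q_def by (rule post.finite_measure_distr[OF \<Psi>])
    show "pPost x \<in> borel_measurable (vol ?S)"
      using pPost_nonneg x space_vol by (intro distributed_real_measurable[OF _ dens]) auto
  qed
  have sQ: "space (Q x) = ?S" "sets (Q x) = sets (vol ?S)" for x
    by (simp_all add: Q_def space_vol)

  have argmin_iff: "is_arg_min (posterior_expected_loss \<Theta> p f \<Psi> B pt l e x) (\<lambda>d. d \<in> pt l ` ?S) d \<longleftrightarrow>
      d \<in> pt l ` ?S \<and> (\<forall>c\<in>pt l ` ?S. truncated_ratio (Q x) e l c \<le> truncated_ratio (Q x) e l d)"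
    if lex: "l > 0" "e > 0" "x \<in> ?D" for l e x d
  proof -
    let ?g = "\<lambda>d \<psi>. indicator (- {d}) (pt l \<psi>) / max e (measure ?P (B l (pt l \<psi>))) :: real"
    have "posterior_expected_loss \<Theta> p f \<Psi> B pt l e x c =
        (\<integral>\<psi>. 1 / max e (measure ?P (B l (pt l \<psi>))) \<partial>Q x) - truncated_ratio (Q x) e l c"
      if c: "c \<in> pt l ` ?S" for c
    proof -
      have "?g c \<in> borel_measurable (vol ?S)"
        by (rule measurable_compose[OF measurable_pt[OF lex(1) space_vol refl]]) simp
      then have "posterior_expected_loss \<Theta> p f \<Psi> B pt l e x c = (\<integral>\<psi>. ?g c \<psi> \<partial>Q x)"
        unfolding posterior_expected_loss_def RB_loss_def discretized_prior_def Q_def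
        using Q(4)[OF lex(3)] by (subst integral_distr) auto
      also have "\<dots> = (\<integral>\<psi>. 1 / max e (measure ?P (B l (pt l \<psi>))) \<partial>Q x) - truncated_ratio (Q x) e l c"
        by (rule expected_loss_eq[OF lex(1,2) Q(2)[OF lex(3)] sQ c])
      finally show ?thesis .
    qed
    then show ?thesis
      unfolding is_arg_min_def by (force simp: not_less)
  qed

  \<comment> \<open>the cells of countably many points suffice as competitors, whatever the data are\<close>
  obtain D :: "'c set" where D: "countable D" "\<And>U. open U \<Longrightarrow> U \<noteq> {} \<Longrightarrow> \<exists>d\<in>D. d \<in> U"
    using countable_dense_setE by blast
  have "D \<inter> ?S \<noteq> {}" using D(2)[OF range_open S_ne] by blast
  define q where "q = from_nat_into (D \<inter> ?S)"
  have q: "q n \<in> ?S" "\<And>U. open U \<Longrightarrow> U \<noteq> {} \<Longrightarrow> U \<subseteq> ?S \<Longrightarrow> \<exists>n. q n \<in> U" for n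
  proof -
    show "q n \<in> ?S" using from_nat_into[OF \<open>D \<inter> ?S \<noteq> {}\<close>, of n] by (auto simp: q_def)
    fix U :: "'c set" assume U: "open U" "U \<noteq> {}" "U \<subseteq> ?S"
    obtain u where "u \<in> D" "u \<in> U" using D(2)[OF U(1,2)] by blast
    then have u: "u \<in> D \<inter> ?S" "u \<in> U" using U(3) by auto
    have "countable (D \<inter> ?S)" using D(1) by simp
    then obtain k where "q k = u"
      using from_nat_into_surj[OF _ u(1)] unfolding q_def by blast
    then show "\<exists>n. q n \<in> U" using u(2) by blast
  qed
  have "0 < measure ?P (B l (q n))" if "l > 0" for n l
    using cell_facts(3)[OF that q(1)] .
  from positive_function_eventually_below[of "\<lambda>n l. measure ?P (B l (q n))", OF this]
  obtain \<eta> where \<eta>: "\<And>l. l > 0 \<Longrightarrow> 0 < \<eta> l" "(\<eta> \<longlongrightarrow> 0) (at_right 0)"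
      "\<And>n. eventually (\<lambda>l. \<eta> l \<le> measure ?P (B l (q n))) (at_right 0)"
    by blast

  have exists: "\<exists>\<delta>. bayes_rule X \<Theta> p f \<Psi> B pt l (\<eta> l) \<delta>" if l: "l > 0" for l
  proof -
    have "\<exists>d. is_arg_min (posterior_expected_loss \<Theta> p f \<Psi> B pt l (\<eta> l) x) (\<lambda>d. d \<in> pt l ` ?S) d"
      if x: "x \<in> ?D" for x
      using truncated_ratio_attains_max[OF l \<eta>(1)[OF l] Q(2)[OF x] sQ(2) S_ne]
        argmin_iff[OF l \<eta>(1)[OF l] x] by blast
    then show ?thesis
      unfolding bayes_rule_def by metis
  qed

  have "((\<lambda>l. \<delta> l x) \<longlongrightarrow> psiRB x) (at_right 0)"
    if bayes: "\<forall>l>0. bayes_rule X \<Theta> p f \<Psi> B pt l (\<eta> l) (\<delta> l)" and x: "x \<in> ?D" for \<delta> x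
  proof (rule maximizers_converge[where Q = "Q x" and h = "pPost x" and q = q and \<eta> = \<eta>])
    let ?RB = "relative_belief_ratio pPsi pPost x"
    show "open ?S" by (rule range_open)
    show "psiRB x \<in> ?S"
      using unique_max x by (auto simp: is_arg_max_def)
    show "\<exists>t < pPost x (psiRB x) / pPsi (psiRB x).
        \<forall>\<psi>\<in>?S. \<epsilon> \<le> dist \<psi> (psiRB x) \<longrightarrow> pPost x \<psi> / pPsi \<psi> \<le> t" if "\<epsilon> > 0" for \<epsilon>
    proof -
      let ?far = "{\<psi> \<in> ?S. \<epsilon> \<le> norm (\<psi> - psiRB x)}"
      have "(SUP \<psi>\<in>?far. ereal (?RB \<psi>)) < ereal (?RB (psiRB x))"
        using separated x that by blast
      \<comment> \<open>the supremum is \<open>-\<infinity>\<close> if no point is far away, so a real number above it is chosen\<close>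
      then obtain t where t: "(SUP \<psi>\<in>?far. ereal (?RB \<psi>)) < ereal t" "ereal t < ereal (?RB (psiRB x))"
        using ereal_dense2 by blast
      have "?RB \<psi> \<le> t" if "\<psi> \<in> ?far" for \<psi>
      proof -
        have "ereal (?RB \<psi>) \<le> (SUP \<psi>\<in>?far. ereal (?RB \<psi>))"
          using that by (rule SUP_upper)
        also note t(1)
        finally show ?thesis by simp
      qed
      then show ?thesis
        using t(2) by (intro exI[of _ t]) (auto simp: relative_belief_ratio_def dist_norm)
    qed
    fix l :: real assume l: "l > 0"
    have "is_arg_min (posterior_expected_loss \<Theta> p f \<Psi> B pt l (\<eta> l) x) (\<lambda>d. d \<in> pt l ` ?S) (\<delta> l x)"
      using bayes l x by (auto simp: bayes_rule_def)
    then have \<delta>: "\<delta> l x \<in> pt l ` ?S \<and>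
        (\<forall>c\<in>pt l ` ?S. truncated_ratio (Q x) (\<eta> l) l c \<le> truncated_ratio (Q x) (\<eta> l) l (\<delta> l x))"
      using argmin_iff[OF l \<eta>(1)[OF l] x] by blast
    then show "\<delta> l x \<in> pt l ` ?S" ..
    show "truncated_ratio (Q x) (\<eta> l) l c \<le> truncated_ratio (Q x) (\<eta> l) l (\<delta> l x)"
      if "c \<in> pt l ` ?S" for c
      using \<delta> that by blast
  qed (use P Q[OF x] q \<eta>(3) pPsi_pos pPsi_cont pPost_nonneg pPost_cont x in auto)
  with \<eta>(1,2) exists show ?thesis
    by (intro exI[of _ \<eta>]) blast
qed

end
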